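(* Let $T=\{1,2,3,4,5,6\}$ and $$\mathcal{M}_3:=\{\{(12,\sigma_1),(34,\sigma_2),(56,\sigma_3)\}\mid \sigma_1,\sigma_2,\sigma_3\in\{\mathrm{odd},\mathrm{even}\}\}.$$ Then $\mathcal{M}_3$ is not h-representable.
   Context: Let $T=\{1,2,\dots,2\tau\}$ (here $\tau=3$). A perfect matching with parity (PMP) on $T$ is a set of pairs $(s_it_i,\sigma_i)$ $(i=1,\dots,\tau)$ such that $\bigcup_i\{s_i,t_i\}=T$ and each $\sigma_i\in\{\mathrm{odd},\mathrm{even}\}$ (here $st$ is the unordered pair $\{s,t\}$). For $p,q\in\mathbb{Z}^{2\tau}$, distinct $s,t\in T$ and a parity $\sigma$, define $[p,q]_{st,\sigma}:=p_sp_t+q_sq_t$ if $\sigma=\mathrm{odd}$, and $[p,q]_{st,\sigma}:=p_sq_t+q_sp_t$ if $\sigma=\mathrm{even}$. A set $\mathcal{M}$ of PMPs on $T$ is h-representable if there exist $N,k\in\mathbb{Z}_{>0}$, $n_i\in\mathbb{Z}_{\ge 0}$, $p^i,q^i\in\mathbb{Z}^{2\tau}$ for $i=1,\dots,N$ such that a PMP $M$ on $T$ belongs to $\mathcal{M}$ if and only if $\sum_{i=1}^N n_i\prod_{(st,\sigma)\in M}[p^i,q^i]_{st,\sigma}\not\equiv 0 \pmod{2^k}$. *)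

theory Defs
  imports "HOL-Number_Theory.Cong"
begin

datatype parity = Odd | Even

text \<open>
  An unordered pair \<open>st\<close> is encoded as the set \<open>{s, t}\<close>.  For a perfect matching with parity,
  covering all \<open>2\<tau>\<close> points by \<open>\<tau>\<close> pairs forces \<open>s i \<noteq> t i\<close> and the pairs to be disjoint.
\<close>

definition is_pmp :: "nat \<Rightarrow> (nat set \<times> parity) set \<Rightarrow> bool" where
  "is_pmp \<tau> M \<longleftrightarrow>
     (\<exists>(s :: nat \<Rightarrow> nat) (t :: nat \<Rightarrow> nat) (\<sigma> :: nat \<Rightarrow> parity).
        M = {({s i, t i}, \<sigma> i) | i. i \<in> {1..\<tau>}} \<and>
        (\<Union>i\<in>{1..\<tau>}. {s i, t i}) = {1..2 * \<tau>})"

text \<open>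
  A vector in \<open>\<int>\<^sup>2\<^sup>\<tau>\<close> is a function \<open>nat \<Rightarrow> int\<close> of which only the values on \<open>{1..2 * \<tau>}\<close> are
  ever used.
\<close>

fun bracket :: "(nat \<Rightarrow> int) \<Rightarrow> (nat \<Rightarrow> int) \<Rightarrow> nat \<Rightarrow> nat \<Rightarrow> parity \<Rightarrow> int" where
  "bracket p q s t Odd = p s * p t + q s * q t"
| "bracket p q s t Even = p s * q t + q s * p t"

text \<open>
  The bracket is symmetric in \<open>s\<close> and \<open>t\<close>, so its value on an unordered pair may be read off from
  the representative with the smaller point first.
\<close>

definition pair_bracket :: "(nat \<Rightarrow> int) \<Rightarrow> (nat \<Rightarrow> int) \<Rightarrow> nat set \<Rightarrow> parity \<Rightarrow> int" where
  "pair_bracket p q e \<sigma> = bracket p q (Min e) (Max e) \<sigma>"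

lemma pair_bracket_pair: "pair_bracket p q {s, t} \<sigma> = bracket p q s t \<sigma>"
  by (cases \<sigma>; cases "s \<le> t") (auto simp: pair_bracket_def min_def max_def algebra_simps)

definition h_representable :: "nat \<Rightarrow> (nat set \<times> parity) set set \<Rightarrow> bool" where
  "h_representable \<tau> \<M> \<longleftrightarrow>
     (\<exists>(N :: nat) (k :: nat) (n :: nat \<Rightarrow> nat) (p :: nat \<Rightarrow> nat \<Rightarrow> int) (q :: nat \<Rightarrow> nat \<Rightarrow> int).
        N > 0 \<and> k > 0 \<and>
        (\<forall>M. is_pmp \<tau> M \<longrightarrow>
          (M \<in> \<M> \<longleftrightarrow>
            \<not> [(\<Sum>i = 1..N. int (n i) * (\<Prod>(e, \<sigma>)\<in>M. pair_bracket (p i) (q i) e \<sigma>)) = 0]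
                (mod 2 ^ k))))"

definition M3 :: "(nat set \<times> parity) set set" where
  "M3 = {{({1, 2}, \<sigma>\<^sub>1), ({3, 4}, \<sigma>\<^sub>2), ({5, 6}, \<sigma>\<^sub>3)} | \<sigma>\<^sub>1 \<sigma>\<^sub>2 \<sigma>\<^sub>3. True}"

lemma is_pmp_M3:
  assumes "M \<in> M3"
  shows "is_pmp 3 M"
proof -
  obtain a b c where M: "M = {({1, 2}, a), ({3, 4}, b), ({5, 6}, c)}"
    using assms by (auto simp: M3_def)
  have I: "{1..3} = {1, 2, 3 :: nat}" "{1..2 * 3} = {1, 2, 3, 4, 5, 6 :: nat}"
    by auto
  let ?\<sigma> = "\<lambda>i :: nat. if i = 1 then a else if i = 2 then b else c"
  have "M = {({2 * i - 1, 2 * i}, ?\<sigma> i) | i :: nat. i \<in> {1..3}}"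
    unfolding M I Setcompr_eq_image by simp
  moreover have "(\<Union>i\<in>{1..3}. {2 * i - 1, 2 * i}) = {1..2 * 3 :: nat}"
    unfolding I by auto
  ultimately show ?thesis
    unfolding is_pmp_def by (intro exI conjI)
qed

end

theory Submission
  imports Defs
begin

text \<open>
  The odd brackets between the rows \<open>{1, 4, 5}\<close> and the columns \<open>{2, 3, 6}\<close> form a \<open>3 \<times> 3\<close> matrix
  of inner products of vectors \<open>(p s, q s)\<close> in the plane.  Its rank is at most 2, so its determinant
  vanishes.  The six terms of the determinant are, up to sign, the products over the six perfect
  matchings between rows and columns; one of these is \<open>{12, 34, 56}\<close>, and none of the other five
  belongs to \<open>\<M>\<^sub>3\<close> under any choice of parities.  If the weighted sums of the other five vanish
  modulo \<open>2 ^ k\<close>, then so does that of \<open>{12, 34, 56}\<close>.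
\<close>

definition odd_matching :: "nat \<Rightarrow> nat \<Rightarrow> nat \<Rightarrow> nat \<Rightarrow> nat \<Rightarrow> nat \<Rightarrow> (nat set \<times> parity) set" where
  "odd_matching a b c d e f = {({a, b}, Odd), ({c, d}, Odd), ({e, f}, Odd)}"

lemma fst_odd_matching: "fst ` odd_matching a b c d e f = {{a, b}, {c, d}, {e, f}}"
  by (simp add: odd_matching_def)

lemma is_pmp_odd_matching:
  assumes "{a, b, c, d, e, f} = {1, 2, 3, 4, 5, 6}"
  shows "is_pmp 3 (odd_matching a b c d e f)"
proof -
  have I: "{1..3} = {1, 2, 3 :: nat}" "{1..2 * 3} = {1, 2, 3, 4, 5, 6 :: nat}"
    by auto
  let ?s = "\<lambda>i :: nat. if i = 1 then a else if i = 2 then c else e"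
  let ?t = "\<lambda>i :: nat. if i = 1 then b else if i = 2 then d else f"
  have "odd_matching a b c d e f = {({?s i, ?t i}, Odd) | i :: nat. i \<in> {1..3}}"
    unfolding odd_matching_def I Setcompr_eq_image by simp
  moreover have "(\<Union>i\<in>{1..3}. {?s i, ?t i}) = {1..2 * 3}"
    using assms unfolding I by auto
  ultimately show ?thesis
    unfolding is_pmp_def by (intro exI[of _ ?s] exI[of _ ?t] exI[of _ "\<lambda>_. Odd"] conjI)
qed

text \<open>Distinct points make the three pairs distinct, so the product over the set keeps all
  three factors.\<close>

lemma prod_odd_matching:
  assumes "distinct [a, b, c, d, e, f]"
  shows "(\<Prod>(x, \<sigma>)\<in>odd_matching a b c d e f. pair_bracket p q x \<sigma>) =
    bracket p q a b Odd * bracket p q c d Odd * bracket p q e f Odd"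
  using assms
  by (simp add: odd_matching_def pair_bracket_pair doubleton_eq_iff mult.assoc del: bracket.simps)

text \<open>Leibniz expansion of the determinant of a product of a 3 x 2 and a 2 x 3 matrix.\<close>

lemma odd_bracket_det_eq_0:
  fixes p q :: "nat \<Rightarrow> int"
  defines "B \<equiv> \<lambda>s t. bracket p q s t Odd"
  shows "B a x * B b y * B c z + B a y * B b z * B c x + B a z * B b x * B c y
    - B a x * B b z * B c y - B a y * B b x * B c z - B a z * B b y * B c x = 0"
  unfolding B_def by (simp add: algebra_simps)

theorem theorem3p5:
  shows "\<not> h_representable 3 M3"
proof
  assume "h_representable 3 M3"
  then obtain N k :: nat and n :: "nat \<Rightarrow> nat" and p q :: "nat \<Rightarrow> nat \<Rightarrow> int" where
    rep: "\<And>M. is_pmp 3 M \<Longrightarrow> M \<in> M3 \<longleftrightarrow>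
      \<not> [(\<Sum>i = 1..N. int (n i) * (\<Prod>(e, \<sigma>)\<in>M. pair_bracket (p i) (q i) e \<sigma>)) = 0] (mod 2 ^ k)"
    unfolding h_representable_def by blast
  define S where "S a b c d e f = (\<Sum>i = 1..N. int (n i) *
    (bracket (p i) (q i) a b Odd * bracket (p i) (q i) c d Odd * bracket (p i) (q i) e f Odd))"
    for a b c d e f
  have S: "odd_matching a b c d e f \<in> M3 \<longleftrightarrow> \<not> 2 ^ k dvd S a b c d e f"
    if "{a, b, c, d, e, f} = {1, 2, 3, 4, 5, 6}" "distinct [a, b, c, d, e, f]" for a b c d e f
    using rep[OF is_pmp_odd_matching[OF that(1)]]
    unfolding prod_odd_matching[OF that(2)] S_def cong_0_iff .
  \<comment> \<open>Testing two pairs suffices: a perfect matching that contains 12 and 56 also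
    contains 34.\<close>
  have zero: "2 ^ k dvd S a b c d e f"
    if "{a, b, c, d, e, f} = {1, 2, 3, 4, 5, 6}" "distinct [a, b, c, d, e, f]"
      "\<not> {{1, 2}, {5, 6}} \<subseteq> {{a, b}, {c, d}, {e, f}}" for a b c d e f
  proof -
    have "{{1, 2}, {5, 6}} \<subseteq> fst ` M" if "M \<in> M3" for M
      using that unfolding M3_def by fastforce
    then have "odd_matching a b c d e f \<notin> M3"
      using that(3) by (metis fst_odd_matching)
    then show ?thesis
      using S[OF that(1,2)] by blast
  qed
  let ?m = "\<lambda>i a b c d e f. bracket (p i) (q i) a b Odd * bracket (p i) (q i) c d Odd
    * bracket (p i) (q i) e f Odd"
  \<comment> \<open>Rows 1, 4, 5 and columns 2, 3, 6, in this order, put 12, 43, 56 on the diagonal.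
    The determinant vanishes for each \<open>i\<close>, hence so does the weighted sum.\<close>
  have "(\<Sum>i = 1..N. int (n i) * (?m i 1 2 4 3 5 6 + ?m i 1 3 4 6 5 2 + ?m i 1 6 4 2 5 3
      - ?m i 1 2 4 6 5 3 - ?m i 1 3 4 2 5 6 - ?m i 1 6 4 3 5 2)) = 0"
    by (simp only: odd_bracket_det_eq_0 mult_zero_right sum.neutral_const)
  then have "S 1 2 4 3 5 6 + S 1 3 4 6 5 2 + S 1 6 4 2 5 3
      - S 1 2 4 6 5 3 - S 1 3 4 2 5 6 - S 1 6 4 3 5 2 = 0"
    by (simp only: S_def distrib_left right_diff_distrib sum.distrib sum_subtractf)
  then have "S 1 2 4 3 5 6 =
      S 1 2 4 6 5 3 + S 1 3 4 2 5 6 + S 1 6 4 3 5 2 - S 1 3 4 6 5 2 - S 1 6 4 2 5 3"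
    by linarith
  moreover have "2 ^ k dvd S 1 3 4 6 5 2" "2 ^ k dvd S 1 6 4 2 5 3" "2 ^ k dvd S 1 2 4 6 5 3"
    "2 ^ k dvd S 1 3 4 2 5 6" "2 ^ k dvd S 1 6 4 3 5 2"
    by (rule zero; simp add: insert_commute doubleton_eq_iff)+
  moreover have "\<not> 2 ^ k dvd S 1 2 4 3 5 6"
  proof -
    have "odd_matching 1 2 4 3 5 6 \<in> M3"
      unfolding odd_matching_def M3_def mem_Collect_eq insert_commute[of 4 3] by blast
    then show ?thesis
      using S[of 1 2 4 3 5 6] by (simp add: insert_commute)
  qed
  ultimately show False
    by (simp add: dvd_add dvd_diff)
qed

end
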